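(* Let $m$ be a positive integer and let $K\subset\mathbb{E}^2$ be a regular convex $n$-sided polygon, where $n\geq 3$. Then $$I^m(K)=\left\lceil\frac{mn}{\left\lfloor\frac{n-1}{2}\right\rfloor}\right\rceil.$$ In addition, if $n$ satisfies one of the following conditions: (i) $n$ is odd and $n\geq 2m+1$, (ii) $n$ is even and $n\geq 4m+2$, then $I^m(K)=2m+1$.
   Context: $\mathbb{E}^2$ is the Euclidean plane and $\mathbb{S}^{1}$ is its origin-centered unit circle. A polygon is regarded as a $2$-dimensional convex body (a compact convex set with nonempty interior); $\partial K$ and $\operatorname{int}(K)$ denote boundary and interior. A direction $u\in\mathbb{S}^{1}$ illuminates a point $p\in\partial K$ with respect to $K$ if $p+\lambda u\in\operatorname{int}(K)$ for some $\lambda>0$. $K$ is $m$-fold illuminated by a finite multiset $U$ of directions in $\mathbb{S}^{1}$ if each point of $\partial K$ is illuminated by at least $m$ members of $U$ (counted with multiplicity) with respect to $K$. The $m$-fold illumination number $I^m(K)$ is the smallest cardinality (counted with multiplicity) of a multiset of directions that $m$-fold illuminates $K$. *)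

theory Defs
  imports "HOL-Analysis.Analysis" "HOL-Library.Multiset"
begin

definition illuminates :: "(real^2) set \<Rightarrow> real^2 \<Rightarrow> real^2 \<Rightarrow> bool" where
  "illuminates K u p \<longleftrightarrow> (\<exists>t>0. p + t *\<^sub>R u \<in> interior K)"

definition m_fold_illuminated :: "nat \<Rightarrow> (real^2) set \<Rightarrow> (real^2) multiset \<Rightarrow> bool" where
  "m_fold_illuminated m K U \<longleftrightarrow>
     set_mset U \<subseteq> sphere 0 1 \<and>
     (\<forall>p \<in> frontier K. m \<le> size {#u \<in># U. illuminates K u p#})"

text \<open>
  On natural numbers \<open>Inf\<close> of a nonempty set is its least element, but \<open>Inf {} = 0\<close>; a positive
  value therefore also says that some finite multiset illuminates \<open>K\<close> \<open>m\<close>-fold.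
\<close>
definition illumination_number :: "nat \<Rightarrow> (real^2) set \<Rightarrow> nat" where
  "illumination_number m K = Inf {size U |U. m_fold_illuminated m K U}"

text \<open>
  The regular convex polygon with \<open>n\<close> sides as the convex hull of \<open>n\<close> points equally spaced on a
  circle of arbitrary centre \<open>c\<close> and radius \<open>r\<close>, the first one at angle \<open>\<theta>\<close>. Only for
  \<open>n \<ge> 3\<close> is this a convex body.
\<close>
definition regular_polygon :: "nat \<Rightarrow> (real^2) set \<Rightarrow> bool" where
  "regular_polygon n K \<longleftrightarrow>
     (\<exists>c r \<theta>. 0 < r \<and>
        K = convex hull
              ((\<lambda>k. c + r *\<^sub>R vector [cos (\<theta> + 2 * pi * real k / real n),
                                       sin (\<theta> + 2 * pi * real k / real n)]) ` {..<n}))"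

end

theory Submission
  imports Defs
begin

text \<open>
  A direction that illuminates a vertex of a convex polygon also illuminates every boundary point
  whose representation as a convex combination gives that vertex positive weight, so only the
  vertices matter. A direction of angle \<open>\<phi>\<close> illuminates the vertex of angle \<open>\<alpha>\<close> iff \<open>\<phi> - \<alpha> - \<pi>\<close>
  is, modulo \<open>2\<pi>\<close>, smaller than \<open>\<pi>/2 - \<pi>/n\<close> in absolute value. Hence one direction illuminates at
  most \<open>q = \<lfloor>(n - 1)/2\<rfloor>\<close> vertices, which gives \<open>mn \<le> q |U|\<close> by double counting, and every block of
  \<open>q\<close> consecutive vertices is illuminated by one direction. Blocks laid end to end around the
  polygon until they have wound \<open>m\<close> times attain the bound.
\<close>

section \<open>Illumination of convex hulls\<close>

text \<open>Peeling off one point at a time, either the removed point carries positive weight or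
  \<open>p\<close> already lies in the smaller hull. The form \<open>y - e *\<^sub>R (y - v)\<close>
  suits the shrinking argument below.\<close>

lemma convex_hull_positive_weight:
  fixes V :: "'a::real_vector set"
  assumes "finite V" "V \<noteq> {}" "p \<in> convex hull V"
  shows "\<exists>v\<in>V. \<exists>e y. 0 < e \<and> e \<le> 1 \<and> y \<in> convex hull V \<and> p = y - e *\<^sub>R (y - v)"
  using assms
proof (induction V rule: finite_ne_induct)
  case (singleton x)
  then show ?case by (auto intro!: exI[of _ 1])
next
  case (insert x F)
  obtain a b w where ab: "0 \<le> a" "0 \<le> b" "a + b = 1" "w \<in> convex hull F"
    "p = a *\<^sub>R x + b *\<^sub>R w"
    using insert.prems insert.hyps by (auto simp: convex_hull_insert)
  have sub: "convex hull F \<subseteq> convex hull (insert x F)"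
    by (intro hull_mono) auto
  show ?case
  proof (cases "a = 0")
    case True
    with ab have "p \<in> convex hull F" by simp
    with insert.IH sub show ?thesis by blast
  next
    case False
    have b: "b = 1 - a" using ab by simp
    have "p = w - a *\<^sub>R (w - x)"
      using ab(5) unfolding b by (simp add: algebra_simps)
    moreover have "0 < a" "a \<le> 1" "w \<in> convex hull insert x F"
      using ab False sub by auto
    ultimately show ?thesis by blast
  qed
qed

text \<open>The contraction towards \<open>y\<close> by the factor \<open>e\<close> sends
  \<open>v\<close> to the new point and keeps the interior point \<open>v + t *\<^sub>R u\<close>
  interior, displaced now by \<open>e * t\<close> along \<open>u\<close>.\<close>

lemma illuminates_of_vertex:
  fixes v y :: "real^2"
  assumes "convex K" "y \<in> K" "0 < e" "e \<le> 1" "illuminates K u v"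
  shows "illuminates K u (y - e *\<^sub>R (y - v))"
proof -
  obtain t where t: "t > 0" "v + t *\<^sub>R u \<in> interior K"
    using assms(5) by (auto simp: illuminates_def)
  have "y - e *\<^sub>R (y - (v + t *\<^sub>R u)) \<in> interior K"
    by (rule mem_interior_convex_shrink) (use assms t in auto)
  moreover have "y - e *\<^sub>R (y - (v + t *\<^sub>R u)) = y - e *\<^sub>R (y - v) + (e * t) *\<^sub>R u"
    by (simp add: algebra_simps)
  ultimately show ?thesis
    using t assms unfolding illuminates_def by (metis mult_pos_pos)
qed

lemma m_fold_illuminated_hullI:
  fixes V :: "(real^2) set"
  assumes V: "finite V" "V \<noteq> {}" and U: "set_mset U \<subseteq> sphere 0 1"
    and ill: "\<And>v. v \<in> V \<Longrightarrow> m \<le> size {#u \<in># U. illuminates (convex hull V) u v#}"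
  shows "m_fold_illuminated m (convex hull V) U"
  unfolding m_fold_illuminated_def
proof (intro conjI ballI)
  fix p assume "p \<in> frontier (convex hull V)"
  moreover have "closed (convex hull V)"
    using V by (simp add: finite_imp_compact_convex_hull compact_imp_closed)
  ultimately have "p \<in> convex hull V"
    using frontier_subset_closed by blast
  then obtain v e y where v: "v \<in> V" "0 < e" "e \<le> 1" "y \<in> convex hull V"
      "p = y - e *\<^sub>R (y - v)"
    using convex_hull_positive_weight[OF V] by blast
  have "m \<le> size {#u \<in># U. illuminates (convex hull V) u v#}"
    using ill v by blast
  also have "\<dots> \<le> size {#u \<in># U. illuminates (convex hull V) u p#}"
    unfolding \<open>p = _\<close>
    by (intro size_mset_mono filter_mset_mono_strong)
       (use v in \<open>auto intro!: illuminates_of_vertex\<close>)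
  finally show "m \<le> size {#u \<in># U. illuminates (convex hull V) u p#}" .
qed (use U in simp)

text \<open>The point \<open>p\<close> is on a supporting line, while the interior is strictly on
  one side of it, so moving along \<open>u\<close> must decrease
  \<open>a \<bullet> x\<close>.\<close>

lemma inner_less_of_illuminates:
  fixes a :: "real^2"
  assumes "K \<subseteq> {x. a \<bullet> x \<le> b}" "a \<noteq> 0" "a \<bullet> p = b" "illuminates K u p"
  shows "a \<bullet> u < 0"
proof -
  obtain t where t: "t > 0" "p + t *\<^sub>R u \<in> interior K"
    using assms by (auto simp: illuminates_def)
  have "interior K \<subseteq> {x. a \<bullet> x < b}"
    using interior_mono[OF assms(1)] assms(2) by simp
  with t have "a \<bullet> (p + t *\<^sub>R u) < b" by blast
  with assms(3) t show ?thesis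
    by (simp add: inner_add_right zero_less_mult_iff mult_less_0_iff)
qed

section \<open>Trigonometry\<close>

definition cis2 :: "real \<Rightarrow> real^2" where
  "cis2 a = vector [cos a, sin a]"

lemma cis2_nth [simp]: "cis2 a $ 1 = cos a" "cis2 a $ 2 = sin a"
  by (simp_all add: cis2_def)

lemma inner_cis2: "cis2 a \<bullet> cis2 b = cos (a - b)"
  by (simp add: inner_vec_def sum_2 cos_diff)

lemma norm_cis2 [simp]: "norm (cis2 a) = 1"
  by (simp add: norm_eq_sqrt_inner inner_cis2)

lemma cis2_neq_0 [simp]: "cis2 a \<noteq> 0"
  using norm_cis2[of a] by force

lemma unit_vector_eq_cis2:
  fixes u :: "real^2"
  assumes "norm u = 1"
  obtains a where "u = cis2 a"
proof -
  have "u \<bullet> u = 1" using assms by (simp add: dot_square_norm)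
  then have "(u $ 1)\<^sup>2 + (u $ 2)\<^sup>2 = 1"
    by (simp add: inner_vec_def sum_2 power2_eq_square)
  then obtain t where "u $ 1 = cos t" "u $ 2 = sin t"
    using sincos_total_2pi by metis
  then show ?thesis
    by (intro that[of t]) (simp add: vec_eq_iff forall_2)
qed

lemma cos_le_cos_of_abs:
  assumes "0 \<le> d" "d \<le> \<bar>y\<bar>" "\<bar>y\<bar> \<le> 2 * pi - d"
  shows "cos y \<le> cos d"
proof -
  have "cos \<bar>y\<bar> \<le> cos d"
  proof (cases "\<bar>y\<bar> \<le> pi")
    case True
    then show ?thesis using assms by (intro cos_monotone_0_pi_le) auto
  next
    case False
    have "cos \<bar>y\<bar> = cos (2 * pi - \<bar>y\<bar>)" by (simp add: cos_diff)
    also have "\<dots> \<le> cos d"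
      using False assms by (intro cos_monotone_0_pi_le) auto
    finally show ?thesis .
  qed
  then show ?thesis by (simp add: abs_if split: if_splits)
qed

text \<open>Reducing \<open>x - pi\<close> to \<open>w\<close> in \<open>[-pi, pi)\<close> flips
  both signs. Whichever of \<open>w + h\<close> and \<open>- w + h\<close> equals
  \<open>\<bar>w\<bar> + h\<close> then has positive cosine and is less than
  \<open>pi / 2\<close>.\<close>

lemma cos_neg_both_imp_near_pi:
  assumes "0 < h" "h < pi / 2" "cos (x - h) < 0" "cos (x + h) < 0"
  obtains z :: int where "\<bar>x - pi - 2 * pi * z\<bar> < pi / 2 - h"
proof -
  define z where "z = \<lfloor>x / (2 * pi)\<rfloor>"
  define w where "w = x - pi - 2 * pi * z"
  have z: "real_of_int z \<le> x / (2 * pi)" "x / (2 * pi) < z + 1"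
    unfolding z_def by linarith+
  have w: "- pi \<le> w" "w < pi"
    using z by (simp_all add: w_def field_simps)
  have eq: "x = w + pi + 2 * pi * z"
    by (simp add: w_def)
  have per: "cos (y + pi + 2 * pi * z) = - cos y" for y
    using cos_int_2pin[of z] sin_int_2pin[of z] by (simp add: cos_add)
  have c: "0 < cos (w - h)" "0 < cos (w + h)"
    using assms(3,4) per[of "w - h"] per[of "w + h"] by (simp_all add: eq algebra_simps)
  \<comment> \<open>The limit \<open>3 * pi / 2\<close> comes from
    \<open>\<bar>w\<bar> \<le> pi\<close> and \<open>h < pi / 2\<close>; up to it the cosine does
    not become positive again.\<close>
  have pos_imp: "y < pi / 2" if "0 \<le> y" "y < 3 * pi / 2" "0 < cos y" for y
  proof (rule ccontr)
    assume "\<not> y < pi / 2"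
    then have "0 \<le> cos (y - pi)"
      using that by (intro cos_ge_zero) auto
    then show False using that by (simp add: cos_diff)
  qed
  have "\<bar>w\<bar> < pi / 2 - h"
  proof (cases "0 \<le> w")
    case True
    then show ?thesis using pos_imp[of "w + h"] w c assms by auto
  next
    case False
    have "cos (- w + h) = cos (w - h)"
      by (metis cos_minus minus_diff_eq add.commute uminus_add_conv_diff)
    then show ?thesis using pos_imp[of "- w + h"] w c assms False by auto
  qed
  then show ?thesis using that by (simp add: w_def)
qed

lemma card_int_open_interval:
  assumes "finite S" "\<And>i::int. i \<in> S \<Longrightarrow> \<bar>x - real_of_int i\<bar> < L"
  shows "real (card S) < 2 * L + 1 \<or> S = {}"
proof (cases "S = {}")
  case False
  then have "Max S \<in> S" "Min S \<in> S" using assms by auto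
  then have "real_of_int (Max S) - Min S < 2 * L"
    using assms(2)[of "Max S"] assms(2)[of "Min S"] by linarith
  moreover have "S \<subseteq> {Min S..Max S}" using assms by auto
  then have "card S \<le> card {Min S..Max S}" by (intro card_mono) auto
  moreover have "Min S \<le> Max S" using assms False by auto
  ultimately show ?thesis by simp linarith
qed simp

section \<open>Regular polygons\<close>

locale regular_ngon =
  fixes n :: nat and c :: "real^2" and r \<theta> :: real
  assumes n_ge: "3 \<le> n" and r_pos: "0 < r"
begin

text \<open>The index is real because half-integers are needed too: \<open>ang (k + 1 / 2)\<close>
  is the angle of the outer normal of the side from vertex \<open>k\<close> to vertex
  \<open>k + 1\<close>.\<close>

definition ang :: "real \<Rightarrow> real" where
  "ang k = \<theta> + 2 * pi * k / real n"

definition vert :: "nat \<Rightarrow> real^2" where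
  "vert k = c + r *\<^sub>R cis2 (ang k)"

definition poly :: "(real^2) set" where
  "poly = convex hull (vert ` {..<n})"

text \<open>This is the \<open>q\<close> of the overview.\<close>

definition halfwidth :: nat where
  "halfwidth = (n - 1) div 2"

lemma halfwidth_bounds: "1 \<le> halfwidth" "halfwidth \<le> n" "2 * halfwidth < n"
  using n_ge by (auto simp: halfwidth_def)

lemma ang_add_multiple: "cis2 (ang (real (k + n * l))) = cis2 (ang (real k))"
proof -
  have "ang (real (k + n * l)) = ang (real k) + 2 * pi * real l"
    using n_ge by (simp add: ang_def field_simps)
  moreover have "cos (a + 2 * pi * real l) = cos a" "sin (a + 2 * pi * real l) = sin a" for a
    using cos_int_2pin[of "int l"] sin_int_2pin[of "int l"]
    by (simp_all add: cos_add sin_add)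
  ultimately show ?thesis
    by (simp add: vec_eq_iff forall_2)
qed

lemma vert_add_multiple: "vert (k + n * l) = vert k"
  unfolding vert_def ang_add_multiple ..

lemma vert_mod: "vert (k mod n) = vert k"
  using vert_add_multiple[of "k mod n" "k div n"] by simp

lemma vert_in_range: "vert k \<in> vert ` {..<n}"
  using n_ge by (subst vert_mod[symmetric]) auto

section \<open>Supporting lines and the bound on vertices illuminated by one direction\<close>

text \<open>The vector \<open>cis2 (ang j)\<close> is the outer normal of a side at vertex
  \<open>i\<close>. Every vertex is at an odd multiple of \<open>pi / n\<close> from it, so none is
  closer in angle than the ends of that side.\<close>

lemma poly_subset_halfspace:
  assumes "j \<in> {k - 1 / 2, k + 1 / 2}" "k = real i" "i < n"
  shows "poly \<subseteq> {x. cis2 (ang j) \<bullet> x \<le> cis2 (ang j) \<bullet> vert i}"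
  unfolding poly_def
proof (rule hull_minimal)
  show "vert ` {..<n} \<subseteq> {x. cis2 (ang j) \<bullet> x \<le> cis2 (ang j) \<bullet> vert i}"
  proof safe
    fix l assume l: "l < n"
    \<comment> \<open>The angle from vertex \<open>l\<close> to the normal in units of
      \<open>pi / n\<close>. It is odd since \<open>j\<close> is a half-integer, and
      \<open>i, l < n\<close> keep it within \<open>2 * n - 1\<close>, short of a full turn.\<close>
    define s where "s = 2 * j - 2 * real l"
    have diff: "ang j - ang (real l) = s * pi / n"
      by (simp add: ang_def s_def diff_divide_distrib algebra_simps)
    have "ang j - ang (real i) = 2 * pi / n * (j - real i)"
      by (simp add: ang_def diff_divide_distrib algebra_simps)
    also have "\<bar>\<dots>\<bar> = pi / n"
      using assms by (auto simp: abs_mult)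
    finally have abs_diff: "\<bar>ang j - ang (real i)\<bar> = pi / n" .
    have "\<exists>w::int. s = w \<and> odd w \<and> \<bar>w\<bar> \<le> 2 * int n - 1"
    proof (cases "j = k - 1 / 2")
      case True
      then show ?thesis using assms l
        by (intro exI[of _ "2 * int i - 2 * int l - 1"]) (auto simp: s_def)
    next
      case False
      then show ?thesis using assms l
        by (intro exI[of _ "2 * int i - 2 * int l + 1"]) (auto simp: s_def)
    qed
    then obtain w :: int where w: "s = w" "odd w" "\<bar>w\<bar> \<le> 2 * int n - 1" by blast
    from w(2) have "w \<noteq> 0" by auto
    then have "1 \<le> \<bar>w\<bar>" by linarith
    then have s: "1 \<le> \<bar>s\<bar>" "\<bar>s\<bar> \<le> 2 * real n - 1" using w by linarith+
    have "cos (s * pi / n) \<le> cos (pi / n)"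
    proof (rule cos_le_cos_of_abs)
      have "1 * (pi / n) \<le> \<bar>s\<bar> * (pi / n)" "\<bar>s\<bar> * (pi / n) \<le> (2 * real n - 1) * (pi / n)"
        using s by (intro mult_right_mono; simp)+
      moreover have "(2 * real n - 1) * (pi / n) = 2 * pi - pi / n"
        using n_ge by (simp add: field_simps)
      ultimately show "pi / n \<le> \<bar>s * pi / n\<bar>" "\<bar>s * pi / n\<bar> \<le> 2 * pi - pi / n"
        by (simp_all add: abs_mult)
    qed auto
    moreover have "cos (ang j - ang (real i)) = cos (pi / n)"
      using abs_diff by (metis cos_abs_real)
    ultimately show "cis2 (ang j) \<bullet> vert l \<le> cis2 (ang j) \<bullet> vert i"
      using r_pos diff by (simp add: vert_def inner_add_right inner_cis2)
  qed
qed (rule convex_halfspace_le)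

lemma vert_in_frontier:
  assumes "i < n"
  shows "vert i \<in> frontier poly"
proof -
  have "vert i \<in> poly"
    unfolding poly_def by (intro hull_inc vert_in_range)
  moreover have "vert i \<notin> interior poly"
    using interior_mono[OF poly_subset_halfspace[of "real i + 1 / 2" "real i" i]] assms
    by auto
  ultimately show ?thesis
    using closure_subset by (auto simp: frontier_def)
qed

text \<open>Both sides at the vertex force a negative inner product with the direction. In units of
  \<open>2 * pi / n\<close> the resulting bound \<open>pi / 2 - pi / n\<close> reads
  \<open>n / 4 - 1 / 2\<close>, and \<open>i + n * z\<close> is a lift of the cyclic index to the
  integers.\<close>

lemma illuminates_vert_imp_near:
  assumes "i < n" "illuminates poly (cis2 \<phi>) (vert i)"
  obtains z :: int where "\<bar>(\<phi> - \<theta> - pi) * n / (2 * pi) - (int i + n * z)\<bar> < n / 4 - 1 / 2"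
proof -
  define x where "x = \<phi> - ang (real i)"
  have neg: "cos (ang j - \<phi>) < 0" if "j \<in> {real i - 1 / 2, real i + 1 / 2}" for j
    using inner_less_of_illuminates[OF poly_subset_halfspace[OF that refl assms(1)] _ refl assms(2)]
    by (simp add: inner_cis2)
  have "ang (real i + 1 / 2) - \<phi> = - (x - pi / n)" "ang (real i - 1 / 2) - \<phi> = - (x + pi / n)"
    using n_ge by (simp_all add: ang_def x_def field_simps)
  then have "cos (- (x - pi / n)) < 0" "cos (- (x + pi / n)) < 0"
    using neg[of "real i + 1 / 2"] neg[of "real i - 1 / 2"] by simp_all
  then have "cos (x - pi / n) < 0" "cos (x + pi / n) < 0"
    by (simp_all only: cos_minus)
  moreover have "0 < pi / n" "pi / n < pi / 2"
    using n_ge by (auto simp: field_simps)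
  ultimately obtain z :: int where z: "\<bar>x - pi - 2 * pi * z\<bar> < pi / 2 - pi / n"
    using cos_neg_both_imp_near_pi by blast
  have eq: "(\<phi> - \<theta> - pi) * n / (2 * pi) - (int i + n * z) = (x - pi - 2 * pi * z) * (n / (2 * pi))"
    using n_ge by (simp add: x_def ang_def field_simps)
  have "\<bar>x - pi - 2 * pi * z\<bar> * (n / (2 * pi)) < (pi / 2 - pi / n) * (n / (2 * pi))"
    using z n_ge by (intro mult_strict_right_mono) auto
  also have "\<dots> = n / 4 - 1 / 2"
    using n_ge by (simp add: field_simps)
  finally show ?thesis
    by (intro that[of z]) (simp only: eq abs_mult, simp)
qed

text \<open>The lifted indices are distinct modulo \<open>n\<close> and lie in an open interval of
  length \<open>n / 2 - 1\<close>, so there are fewer than \<open>n / 2\<close> of them.\<close>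

lemma card_illuminated_le:
  assumes "norm u = 1"
  shows "card {i. i < n \<and> illuminates poly u (vert i)} \<le> halfwidth"
proof -
  obtain \<phi> where u: "u = cis2 \<phi>"
    using unit_vector_eq_cis2[OF assms] by blast
  define S where "S = {i. i < n \<and> illuminates poly u (vert i)}"
  define x where "x = (\<phi> - \<theta> - pi) * n / (2 * pi)"
  have "\<forall>i\<in>S. \<exists>z::int. \<bar>x - (int i + n * z)\<bar> < n / 4 - 1 / 2"
    using illuminates_vert_imp_near unfolding S_def u x_def by blast
  then obtain f :: "nat \<Rightarrow> int" where f: "\<And>i. i \<in> S \<Longrightarrow> \<bar>x - (int i + n * f i)\<bar> < n / 4 - 1 / 2"
    by metis
  define g where "g i = int i + int n * f i" for i
  have "inj_on g S"
  proof (rule inj_onI)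
    fix i j assume "i \<in> S" "j \<in> S" "g i = g j"
    then have "g i mod n = g j mod n" "i < n" "j < n" by (simp_all add: S_def)
    then show "i = j" by (simp add: g_def)
  qed
  then have "card (g ` S) = card S" by (rule card_image)
  moreover have "finite S" by (simp add: S_def)
  then have "real (card (g ` S)) < 2 * (n / 4 - 1 / 2) + 1 \<or> g ` S = {}"
    using f by (intro card_int_open_interval[where x = x]) (auto simp: g_def)
  ultimately have "2 * card S < n \<or> card S = 0" by auto
  then have "card S \<le> halfwidth" by (auto simp: halfwidth_def)
  then show ?thesis by (simp add: S_def)
qed

section \<open>Directions that illuminate a vertex or a block of vertices\<close>

text \<open>The direction is a positive combination of the two edge vectors at the vertex, so a
  short step enters the open triangle spanned by the vertex and its neighbours.\<close>

lemma illuminates_vert: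
  assumes "\<bar>\<delta>\<bar> < pi / 2 - pi / n"
  shows "illuminates poly (cis2 (ang (real k) + pi + \<delta>)) (vert k)"
proof -
  define a where "a = ang (real k)"
  define h where "h = 2 * pi / n"
  \<comment> \<open>the predecessor of vertex \<open>k\<close>, avoiding \<open>k - 1\<close> on naturals\<close>
  define k' where "k' = k + (n - 1)"
  have h: "0 < h" "h < pi" using n_ge by (auto simp: h_def field_simps)
  have succ: "vert (Suc k) = c + r *\<^sub>R cis2 (a + h)"
    using n_ge by (simp add: vert_def a_def h_def ang_def field_simps)
  have k': "real k' = real k + real n - 1" using n_ge by (simp add: k'_def of_nat_diff)
  have "ang (real k') = a - h + 2 * pi"
    unfolding k' using n_ge by (simp add: a_def h_def ang_def field_simps)
  then have "vert k' = c + r *\<^sub>R cis2 (a - h + 2 * pi)"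
    by (simp add: vert_def)
  also have "cis2 (a - h + 2 * pi) = cis2 (a - h)"
    by (simp add: vec_eq_iff forall_2)
  finally have pred: "vert k' = c + r *\<^sub>R cis2 (a - h)" .
  have cur: "vert k = c + r *\<^sub>R cis2 a" by (simp add: vert_def a_def)
  have sinh: "0 < sin h" using h by (simp add: sin_gt_zero)
  have cosh: "cos h < 1" using h cos_monotone_0_pi[of 0 h] by simp
  \<comment> \<open>Split along \<open>cis2 a\<close> and its perpendicular, the edge vectors with
    weights \<open>A\<close>, \<open>B\<close> yield the direction iff \<open>A + B = C\<close> and
    \<open>A - B = - S\<close>.\<close>
  define C S where "C = cos \<delta> / (1 - cos h)" and "S = sin \<delta> / sin h"
  define A B where "A = (C - S) / 2" and "B = (C + S) / 2"
  \<comment> \<open>Half-angle formulas turn \<open>A\<close> and \<open>B\<close> into positive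
    multiples of \<open>cos (\<delta> + h / 2)\<close> and \<open>cos (\<delta> - h / 2)\<close>; as
    \<open>h / 2 = pi / n\<close>, the hypothesis makes both positive.\<close>
  have half: "1 - cos h = 2 * sin (h / 2) * sin (h / 2)" "sin h = 2 * sin (h / 2) * cos (h / 2)"
    using cos_double_sin[of "h / 2"] sin_double[of "h / 2"] by (simp_all add: power2_eq_square)
  have sh: "0 < sin (h / 2)" "0 < cos (h / 2)"
    using h by (auto intro!: sin_gt_zero cos_gt_zero)
  have "h / 2 = pi / n" by (simp add: h_def)
  then have "0 < cos (\<delta> + h / 2)" "0 < cos (\<delta> - h / 2)"
    using assms h by (auto intro!: cos_gt_zero_pi)
  moreover have "A = cos (\<delta> + h / 2) / (4 * sin (h / 2) * sin (h / 2) * cos (h / 2))"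
    "B = cos (\<delta> - h / 2) / (4 * sin (h / 2) * sin (h / 2) * cos (h / 2))"
    unfolding A_def B_def C_def S_def half cos_add cos_diff using sh by (simp_all add: field_simps)
  ultimately have AB: "0 < A" "0 < B"
    using sh by simp_all
  have comb: "A *\<^sub>R (cis2 (a + h) - cis2 a) + B *\<^sub>R (cis2 (a - h) - cis2 a) = cis2 (a + pi + \<delta>)"
  proof -
    have "A + B = C" "A - B = - S" by (simp_all add: A_def B_def field_simps)
    then have 1: "(A + B) * (1 - cos h) = cos \<delta>" and 2: "(A - B) * sin h = - sin \<delta>"
      using sinh cosh by (simp_all add: C_def S_def)
    have "A * (cos (a + h) - cos a) + B * (cos (a - h) - cos a)
        = - ((A + B) * (1 - cos h)) * cos a - ((A - B) * sin h) * sin a"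
      by (simp add: cos_add cos_diff algebra_simps)
    also have "\<dots> = cos (a + pi + \<delta>)" unfolding 1 2 by (simp add: cos_add)
    finally have c1: "A * (cos (a + h) - cos a) + B * (cos (a - h) - cos a) = cos (a + pi + \<delta>)" .
    have "A * (sin (a + h) - sin a) + B * (sin (a - h) - sin a)
        = - ((A + B) * (1 - cos h)) * sin a + ((A - B) * sin h) * cos a"
      by (simp add: sin_add sin_diff algebra_simps)
    also have "\<dots> = sin (a + pi + \<delta>)" unfolding 1 2 by (simp add: sin_add)
    finally have "A * (sin (a + h) - sin a) + B * (sin (a - h) - sin a) = sin (a + pi + \<delta>)" .
    with c1 show ?thesis by (simp add: vec_eq_iff forall_2)
  qed
  have "\<not> collinear {vert (Suc k), vert k, vert k'}"
  proof
    assume "collinear {vert (Suc k), vert k, vert k'}"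
    then have "collinear {0, vert (Suc k) - vert k, vert k' - vert k}"
      by (subst (asm) collinear_3) (simp_all add: NO_MATCH_def)
    then have "(vert (Suc k) - vert k) $ 1 * (vert k' - vert k) $ 2
        = (vert (Suc k) - vert k) $ 2 * (vert k' - vert k) $ 1"
      unfolding collinear_lemma by (auto simp del: vector_minus_component)
    then have "r * r * ((cos (a + h) - cos a) * (sin (a - h) - sin a)
        - (sin (a + h) - sin a) * (cos (a - h) - cos a)) = 0"
      unfolding succ pred cur by (simp add: algebra_simps)
    then have "(cos (a + h) - cos a) * (sin (a - h) - sin a)
        - (sin (a + h) - sin a) * (cos (a - h) - cos a) = 0"
      using r_pos by simp
    moreover have "(cos (a + h) - cos a) * (sin (a - h) - sin a)
        - (sin (a + h) - sin a) * (cos (a - h) - cos a)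
        = 2 * sin h * (1 - cos h) * ((sin a)\<^sup>2 + (cos a)\<^sup>2)"
      unfolding cos_add cos_diff sin_add sin_diff by algebra
    ultimately show False using sinh cosh by simp
  qed
  then have int: "interior (convex hull {vert (Suc k), vert k, vert k'})
      = {v. \<exists>x y z. 0 < x \<and> 0 < y \<and> 0 < z \<and> x + y + z = 1 \<and>
           x *\<^sub>R vert (Suc k) + y *\<^sub>R vert k + z *\<^sub>R vert k' = v}"
    by (intro interior_convex_hull_3_minimal) auto
  \<comment> \<open>With this \<open>e\<close> the neighbours share weight \<open>1 / 2\<close> and
    the vertex keeps the other half, so all three barycentric coordinates are positive.\<close>
  define e where "e = 1 / (2 * (A + B))"
  have "0 < A + B" using AB by simp
  then have "0 < e" "e * (A + B) = 1 / 2" by (simp_all add: e_def)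
  then have e: "0 < e" "e * A + e * B = 1 / 2" by (simp_all only: distrib_left)
  have "vert k + (e * r) *\<^sub>R cis2 (a + pi + \<delta>)
      = (e * A) *\<^sub>R vert (Suc k) + (1 - (e * A + e * B)) *\<^sub>R vert k + (e * B) *\<^sub>R vert k'"
    unfolding succ pred cur comb[symmetric] by (simp add: algebra_simps)
  then have "vert k + (e * r) *\<^sub>R cis2 (a + pi + \<delta>) \<in> interior (convex hull {vert (Suc k), vert k, vert k'})"
    unfolding int using e AB
    by (intro CollectI exI[of _ "e * A"] exI[of _ "1 - (e * A + e * B)"] exI[of _ "e * B"]) auto
  also have "\<dots> \<subseteq> interior poly"
    unfolding poly_def using vert_in_range by (intro interior_mono hull_mono) auto
  finally show ?thesis
    unfolding illuminates_def a_def using e r_pos by (intro exI[of _ "e * r"]) auto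
qed

text \<open>The mean index of the block \<open>s, ..., s + halfwidth - 1\<close> is
  \<open>s + (halfwidth - 1) / 2\<close>; the direction is opposite to the middle of the
  block.\<close>

definition block_dir :: "nat \<Rightarrow> real^2" where
  "block_dir s = cis2 (ang (real s + (real halfwidth - 1) / 2) + pi)"

text \<open>Indices in the block differ from its middle by at most
  \<open>(halfwidth - 1) / 2\<close>, which is below \<open>n / 4 - 1 / 2\<close> because
  \<open>2 * halfwidth < n\<close>.\<close>

lemma illuminates_block:
  assumes "i < halfwidth"
  shows "illuminates poly (block_dir s) (vert (s + i))"
proof -
  define d where "d = (real halfwidth - 1) / 2 - real i"
  have "real (2 * halfwidth) < real n" using halfwidth_bounds by linarith
  moreover have "real i + 1 \<le> real halfwidth" using assms by linarith
  then have "\<bar>d\<bar> \<le> (real halfwidth - 1) / 2"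
    unfolding d_def by (simp add: abs_le_iff field_simps)
  ultimately have "\<bar>d\<bar> < real n / 4 - 1 / 2" by auto
  then have "2 * pi / n * \<bar>d\<bar> < 2 * pi / n * (real n / 4 - 1 / 2)"
    using n_ge by (intro mult_strict_left_mono) auto
  also have "\<dots> = pi / 2 - pi / n" using n_ge by (simp add: field_simps)
  finally have "\<bar>2 * pi / n * d\<bar> < pi / 2 - pi / n" by (simp add: abs_mult)
  then have "illuminates poly (cis2 (ang (real (s + i)) + pi + 2 * pi / n * d)) (vert (s + i))"
    by (rule illuminates_vert)
  moreover have "ang (real (s + i)) + pi + 2 * pi / n * d
      = ang (real s + (real halfwidth - 1) / 2) + pi"
    using n_ge by (simp add: ang_def d_def field_simps)
  ultimately show ?thesis by (simp only: block_dir_def)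
qed

section \<open>Double counting, winding blocks, and the exact value\<close>

lemma size_ge_of_m_fold_illuminated:
  assumes "m_fold_illuminated m poly U"
  shows "m * n \<le> halfwidth * size U"
proof -
  \<comment> \<open>Induction on the multiset counts incidences with multiplicity; each added
    direction contributes at most \<open>halfwidth\<close>.\<close>
  have count: "(\<Sum>i<n. size {#u \<in># U. illuminates poly u (vert i)#}) \<le> halfwidth * size U"
    if "set_mset U \<subseteq> sphere 0 1" for U
    using that
  proof (induction U)
    case (add u U)
    have "(\<Sum>i<n. size {#w \<in># add_mset u U. illuminates poly w (vert i)#})
        = (\<Sum>i<n. (if illuminates poly u (vert i) then 1 else 0)
             + size {#w \<in># U. illuminates poly w (vert i)#})"
      by (intro sum.cong) auto
    also have "\<dots> = card {i. i < n \<and> illuminates poly u (vert i)}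
        + (\<Sum>i<n. size {#w \<in># U. illuminates poly w (vert i)#})"
      by (simp add: sum.distrib sum.If_cases Int_def)
    also have "\<dots> \<le> halfwidth + halfwidth * size U"
      using add card_illuminated_le[of u] by (intro add_mono) auto
    finally show ?case by simp
  qed simp
  have "m * n = (\<Sum>i<n. m)" by simp
  also have "\<dots> \<le> (\<Sum>i<n. size {#u \<in># U. illuminates poly u (vert i)#})"
    using assms vert_in_frontier by (intro sum_mono) (auto simp: m_fold_illuminated_def)
  also have "\<dots> \<le> halfwidth * size U"
    using assms by (intro count) (auto simp: m_fold_illuminated_def)
  finally show ?thesis .
qed

lemma m_fold_illuminated_blocks:
  assumes "m * n \<le> halfwidth * N"
  shows "m_fold_illuminated m poly (image_mset (\<lambda>j. block_dir (j * halfwidth)) (mset_set {..<N}))"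
  unfolding poly_def
proof (rule m_fold_illuminated_hullI, fold poly_def)
  let ?q = halfwidth
  let ?U = "image_mset (\<lambda>j. block_dir (j * ?q)) (mset_set {..<N})"
  show "finite (vert ` {..<n})" "vert ` {..<n} \<noteq> {}" using vert_in_range by auto
  show "set_mset ?U \<subseteq> sphere 0 1" by (auto simp: block_dir_def)
  fix v assume "v \<in> vert ` {..<n}"
  then obtain k where k: "k < n" "v = vert k" by auto
  \<comment> \<open>vertex \<open>k\<close> is met once in each of the \<open>m\<close> turns, by the block containing position \<open>k + n l\<close>\<close>
  define f where "f l = (k + n * l) div ?q" for l
  have q: "0 < ?q" using halfwidth_bounds by simp
  have step: "f l < f (Suc l)" for l
  proof -
    \<comment> \<open>One turn is at least one block long, as \<open>halfwidth \<le> n\<close>, so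
      different turns meet the vertex in different blocks.\<close>
    have "f l + 1 = (k + n * l + ?q) div ?q" using q by (simp add: f_def)
    also have "\<dots> \<le> f (Suc l)"
      unfolding f_def using halfwidth_bounds by (intro div_le_mono) auto
    finally show ?thesis by simp
  qed
  then have "inj f" by (intro strict_mono_imp_inj_on) (simp add: strict_mono_Suc_iff)
  moreover have "f ` {..<m} \<subseteq> {j \<in> {..<N}. illuminates poly (block_dir (j * ?q)) v}"
  proof safe
    fix l assume l: "l < m"
    have "k + n * l < n * Suc l" using k by simp
    also have "\<dots> \<le> n * m" using l by (intro mult_left_mono) auto
    also have "\<dots> \<le> N * ?q" using assms by (simp add: mult.commute)
    finally show "f l < N" unfolding f_def using q by (simp add: less_mult_imp_div_less)
    have "illuminates poly (block_dir (f l * ?q)) (vert (f l * ?q + (k + n * l) mod ?q))"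
      using q by (intro illuminates_block) auto
    then show "illuminates poly (block_dir (f l * ?q)) v"
      by (simp add: f_def k vert_add_multiple)
  qed
  ultimately have "m \<le> card {j \<in> {..<N}. illuminates poly (block_dir (j * ?q)) v}"
    using card_inj_on_le[of f "{..<m}" "{j \<in> {..<N}. illuminates poly (block_dir (j * ?q)) v}"]
    by (simp add: inj_on_subset)
  \<comment> \<open>The multiset is indexed by \<open>j\<close>, so blocks with equal directions
    still count separately.\<close>
  then show "m \<le> size {#u \<in># ?U. illuminates poly u v#}"
    by (simp add: filter_mset_image_mset filter_mset_mset_set)
qed

text \<open>Both bounds amount to \<open>m * n \<le> halfwidth * N\<close>, which says that
  \<open>N\<close> is at least the ceiling. That the minimum is attained rules out the default value
  of \<open>Inf\<close> on the empty set.\<close>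

lemma illumination_number_poly:
  "int (illumination_number m poly) = \<lceil>real m * real n / real halfwidth\<rceil>"
proof -
  have q: "0 < real halfwidth" using halfwidth_bounds by simp
  have iff: "m * n \<le> halfwidth * N \<longleftrightarrow> \<lceil>real m * real n / real halfwidth\<rceil> \<le> int N" for N
  proof -
    have "m * n \<le> halfwidth * N \<longleftrightarrow> real (m * n) \<le> real (halfwidth * N)"
      by (simp only: of_nat_le_iff)
    also have "\<dots> \<longleftrightarrow> \<lceil>real m * real n / real halfwidth\<rceil> \<le> int N"
      using q by (simp add: ceiling_le_iff divide_le_eq mult.commute)
    finally show ?thesis .
  qed
  define N where "N = nat \<lceil>real m * real n / real halfwidth\<rceil>"
  have "0 \<le> real m * real n / real halfwidth" by simp
  then have N: "int N = \<lceil>real m * real n / real halfwidth\<rceil>"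
    unfolding N_def by linarith
  have "illumination_number m poly = N"
    unfolding illumination_number_def
  proof (rule cInf_eq_minimum)
    have "m_fold_illuminated m poly (image_mset (\<lambda>j. block_dir (j * halfwidth)) (mset_set {..<N}))"
      using iff[of N] N by (intro m_fold_illuminated_blocks) simp
    then show "N \<in> {size U |U. m_fold_illuminated m poly U}"
      by (intro CollectI exI[of _ "image_mset (\<lambda>j. block_dir (j * halfwidth)) (mset_set {..<N})"]) simp
  next
    fix x assume "x \<in> {size U |U. m_fold_illuminated m poly U}"
    then show "N \<le> x"
      using size_ge_of_m_fold_illuminated iff N by fastforce
  qed
  with N show ?thesis by simp
qed

end

section \<open>Transfer to an arbitrary regular polygon and evaluation of the ceiling for large
  \<open>n\<close>\<close>

theorem theorem1p8:
  fixes m n :: nat and K :: "(real^2) set"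
  assumes "m \<ge> 1" and "n \<ge> 3" and "regular_polygon n K"
  shows "int (illumination_number m K)
           = \<lceil>real m * real n / real_of_int \<lfloor>(real n - 1) / 2\<rfloor>\<rceil> \<and>
         ((odd n \<and> n \<ge> 2 * m + 1) \<or> (even n \<and> n \<ge> 4 * m + 2)
           \<longrightarrow> illumination_number m K = 2 * m + 1)"
proof -
  obtain c r \<theta> where r: "0 < r" and K: "K = convex hull
      ((\<lambda>k. c + r *\<^sub>R vector [cos (\<theta> + 2 * pi * real k / real n),
                               sin (\<theta> + 2 * pi * real k / real n)]) ` {..<n})"
    using assms(3) unfolding regular_polygon_def by blast
  interpret P: regular_ngon n c r \<theta>
    using assms(2) r by unfold_locales
  have "K = P.poly"
    unfolding K P.poly_def P.vert_def P.ang_def cis2_def ..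
  then have main: "int (illumination_number m K) = \<lceil>real m * real n / real P.halfwidth\<rceil>"
    using P.illumination_number_poly by simp
  have q: "real_of_int \<lfloor>(real n - 1) / 2\<rfloor> = real P.halfwidth"
  proof -
    have "\<lfloor>(real n - 1) / 2\<rfloor> = \<lfloor>real (n - 1) / real 2\<rfloor>" using assms(2) by (simp add: of_nat_diff)
    also have "\<dots> = int P.halfwidth" unfolding floor_divide_of_nat_eq P.halfwidth_def ..
    finally show ?thesis by simp
  qed
  have "illumination_number m K = 2 * m + 1"
    if "(odd n \<and> n \<ge> 2 * m + 1) \<or> (even n \<and> n \<ge> 4 * m + 2)"
  proof -
    define q where "q = real P.halfwidth"
    have qpos: "0 < q" using P.halfwidth_bounds by (simp add: q_def)
    \<comment> \<open>\<open>n = 2q + 1\<close> with \<open>m \<le> q\<close>, or \<open>n = 2q + 2\<close> with \<open>2m \<le> q\<close>\<close>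
    have "2 * (real m * q) < real m * real n \<and> real m * real n \<le> (2 * real m + 1) * q"
      using that
    proof
      assume o: "odd n \<and> n \<ge> 2 * m + 1"
      then have "n = 2 * P.halfwidth + 1" "m \<le> P.halfwidth"
        by (auto simp: P.halfwidth_def elim!: oddE)
      then have "real n = 2 * q + 1" "real m \<le> q" by (simp_all add: q_def)
      then show ?thesis using assms(1) by (simp add: algebra_simps)
    next
      assume e: "even n \<and> n \<ge> 4 * m + 2"
      then have "n = 2 * P.halfwidth + 2" "2 * m \<le> P.halfwidth"
        by (auto simp: P.halfwidth_def elim!: evenE)
      then have "real n = 2 * q + 2" "2 * real m \<le> q" by (simp_all add: q_def)
      then show ?thesis using assms(1) by (simp add: algebra_simps)
    qed
    \<comment> \<open>The product \<open>m * n\<close> exceeds \<open>2 * m * q\<close> by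
      \<open>m\<close> or \<open>2 * m\<close>, which is positive and at most \<open>q\<close>, so
      the quotient lies in \<open>(2 * m, 2 * m + 1]\<close>.\<close>
    then have "\<lceil>real m * real n / q\<rceil> = 2 * int m + 1"
      using qpos by (intro ceiling_unique) (simp_all add: field_simps)
    then show ?thesis using main by (simp add: q_def)
  qed
  with main q show ?thesis by simp
qed

end
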